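(* For every circle $I=\langle q\rangle$ at infinity, the integer $B_{I,I}$ is even.
   Context: Let $z_\infty=1/z$. An exponential factor at infinity is a polynomial $q$ without constant term in $z_\infty^{-1/\beta}$ for some $\beta\ge1$; the smallest possible $\beta$ is its ramification order, its degree in $z_\infty^{-1/\beta}$ is its irregularity, and its slope is irregularity divided by ramification (slope of $0$ is $0$). Its Galois conjugates $q_i$ ($i=0,\dots,\beta-1$) are obtained by $z_\infty^{1/\beta}\mapsto\omega z_\infty^{1/\beta}$ with $\omega^\beta=1$, and the circle $\langle q\rangle$ is its Galois orbit. The number of (oriented) loops at $I=\langle q\rangle$ is defined as $$B_{I,I}=\mathrm{Irr}(\mathrm{End}(I))-\beta^2+1,\qquad \mathrm{Irr}(\mathrm{End}(I))=\sum_{i=0}^{\beta-1}\sum_{j=0}^{\beta-1}\mathrm{slope}(q_i-q_j).$$ *)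

theory Defs
  imports
    Complex_Main
    "HOL-Library.Poly_Mapping"
    "HOL-Computational_Algebra.Polynomial"
begin

text \<open>
  Write z for the coordinate of the affine line, so that the local coordinate at infinity is
  1/z and its power with exponent -1/b is z to the power 1/b. A finite sum of complex multiples
  of rational powers of z is encoded by its coefficient function, sending the exponent r to the
  coefficient of z to the power r. In this encoding there is no choice of b: the addition and
  subtraction of factors with different ramification orders are those of \<^typ>\<open>rat \<Rightarrow>\<^sub>0 complex\<close>.
\<close>

type_synonym puiseux_poly = "rat \<Rightarrow>\<^sub>0 complex"

text \<open>\<open>subst_root b p\<close> is the polynomial p evaluated at z to the power 1/b.\<close>

definition subst_root :: "nat \<Rightarrow> complex poly \<Rightarrow> puiseux_poly" where
  "subst_root b p =
     (\<Sum>i\<le>degree p. Poly_Mapping.single (rat_of_nat i / rat_of_nat b) (coeff p i))"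

definition poly_in_root :: "nat \<Rightarrow> puiseux_poly \<Rightarrow> bool" where
  "poly_in_root b q \<longleftrightarrow> (\<exists>p. coeff p 0 = 0 \<and> q = subst_root b p)"

definition exp_factor :: "puiseux_poly \<Rightarrow> bool" where
  "exp_factor q \<longleftrightarrow> (\<exists>b\<ge>1. poly_in_root b q)"

definition ramification :: "puiseux_poly \<Rightarrow> nat" where
  "ramification q = (LEAST b. b \<ge> 1 \<and> poly_in_root b q)"

definition root_poly :: "puiseux_poly \<Rightarrow> complex poly" where
  "root_poly q = (THE p. q = subst_root (ramification q) p)"

text \<open>The degree of the zero polynomial is 0 here, so the slope of 0 is 0.\<close>

definition irregularity :: "puiseux_poly \<Rightarrow> nat" where
  "irregularity q = degree (root_poly q)"

definition slope :: "puiseux_poly \<Rightarrow> rat" where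
  "slope q = rat_of_nat (irregularity q) / rat_of_nat (ramification q)"

text \<open>
  The action of a root of unity \<open>\<omega>\<close> of order dividing the ramification order b multiplies
  the b-th root of the local coordinate 1/z by \<open>\<omega>\<close>, hence the b-th root of z by its inverse.
\<close>

definition galois :: "complex \<Rightarrow> puiseux_poly \<Rightarrow> puiseux_poly" where
  "galois \<omega> q = subst_root (ramification q) (pcompose (root_poly q) [:0, inverse \<omega>:])"

definition conjugate :: "puiseux_poly \<Rightarrow> nat \<Rightarrow> puiseux_poly" where
  "conjugate q i = galois (cis (2 * pi * real i / real (ramification q))) q"

definition circle :: "puiseux_poly \<Rightarrow> puiseux_poly set" where
  "circle q = {galois \<omega> q | \<omega>. \<omega> ^ ramification q = 1}"

definition irr_End_factor :: "puiseux_poly \<Rightarrow> rat" where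
  "irr_End_factor q =
     (\<Sum>i<ramification q. \<Sum>j<ramification q. slope (conjugate q i - conjugate q j))"

definition num_loops_factor :: "puiseux_poly \<Rightarrow> rat" where
  "num_loops_factor q = irr_End_factor q - (rat_of_nat (ramification q))\<^sup>2 + 1"

text \<open>
  The number of loops is attached to the circle, by means of a representative; the lemma
  \<open>num_loops_circle\<close> below says that every representative gives the same value.
\<close>

definition num_loops :: "puiseux_poly set \<Rightarrow> rat" where
  "num_loops I = num_loops_factor (SOME q. exp_factor q \<and> circle q = I)"

lemma lookup_subst_root:
  assumes "b \<ge> 1"
  shows "Poly_Mapping.lookup (subst_root b p) (rat_of_nat i / rat_of_nat b) = coeff p i"
proof -
  have "Poly_Mapping.lookup (subst_root b p) (rat_of_nat i / rat_of_nat b)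
      = (\<Sum>k\<le>degree p. if k = i then coeff p k else 0)"
    unfolding subst_root_def lookup_sum
    by (rule sum.cong) (use assms in \<open>auto simp: lookup_single when_def\<close>)
  also have "\<dots> = coeff p i"
    by (auto simp: sum.delta coeff_eq_0)
  finally show ?thesis .
qed

lemma subst_root_inject:
  assumes "b \<ge> 1" "subst_root b p = subst_root b p'"
  shows "p = p'"
  by (rule poly_eqI) (metis assms lookup_subst_root)

lemma exp_factor_ramification:
  assumes "exp_factor q"
  shows "ramification q \<ge> 1" "poly_in_root (ramification q) q"
proof -
  have "\<exists>b. b \<ge> 1 \<and> poly_in_root b q"
    using assms by (auto simp: exp_factor_def)
  from LeastI_ex[OF this]
  show "ramification q \<ge> 1" "poly_in_root (ramification q) q"
    by (simp_all add: ramification_def)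
qed

lemma ramification_le: "b \<ge> 1 \<Longrightarrow> poly_in_root b q \<Longrightarrow> ramification q \<le> b"
  unfolding ramification_def by (rule Least_le) simp

lemma root_poly_eqI:
  assumes "exp_factor q" "q = subst_root (ramification q) p"
  shows "root_poly q = p"
  unfolding root_poly_def
  using assms exp_factor_ramification(1)[OF assms(1)] subst_root_inject
  by (intro the_equality) metis+

lemma exp_factor_root_poly:
  assumes "exp_factor q"
  shows "q = subst_root (ramification q) (root_poly q)" "coeff (root_poly q) 0 = 0"
  using exp_factor_ramification(2)[OF assms] root_poly_eqI[OF assms]
  unfolding poly_in_root_def by metis+

lemma pcompose_linear_linear:
  fixes p :: "complex poly"
  shows "pcompose (pcompose p [:0, a:]) [:0, b:] = pcompose p [:0, a * b:]"
  by (rule poly_eqI) (simp add: coeff_pcompose_linear power_mult_distrib mult_ac)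

lemma poly_in_root_galois:
  assumes "exp_factor q"
  shows "poly_in_root (ramification q) (galois \<omega> q)"
  unfolding poly_in_root_def galois_def
  using exp_factor_root_poly(2)[OF assms]
  by (intro exI[of _ "pcompose (root_poly q) [:0, inverse \<omega>:]"]) (simp add: coeff_pcompose_linear poly_0_coeff_0)

lemma exp_factor_galois: "exp_factor q \<Longrightarrow> exp_factor (galois \<omega> q)"
  using poly_in_root_galois exp_factor_ramification(1) unfolding exp_factor_def by blast

lemma self_in_circle:
  assumes "exp_factor q"
  shows "q \<in> circle q"
proof -
  have "galois 1 q = q"
    using exp_factor_root_poly(1)[OF assms] by (simp add: galois_def pcompose_idR)
  thus ?thesis unfolding circle_def by (auto intro!: exI[of _ 1])
qed

lemma num_loops_factor_roots:
  assumes "exp_factor q"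
  defines "R \<equiv> {\<omega>::complex. \<omega> ^ ramification q = 1}"
  shows "irr_End_factor q = (\<Sum>\<omega>\<in>R. \<Sum>\<omega>'\<in>R. slope (galois \<omega> q - galois \<omega>' q))"
proof -
  have bij: "bij_betw (\<lambda>k. cis (2 * pi * real k / real (ramification q))) {..<ramification q} R"
    unfolding R_def using bij_betw_roots_unity exp_factor_ramification(1)[OF assms(1)] by simp
  show ?thesis
    unfolding irr_End_factor_def conjugate_def
    by (simp add: sum.reindex_bij_betw[OF bij, symmetric])
qed

lemma num_loops_factor_eq:
  assumes q: "exp_factor q" and q': "exp_factor q'" and eq: "circle q = circle q'"
  shows "num_loops_factor q = num_loops_factor q'"
proof -
  have "q' \<in> circle q" "q \<in> circle q'" using self_in_circle q q' eq by auto
  then obtain \<zeta> \<xi> where z: "q' = galois \<zeta> q" "\<zeta> ^ ramification q = 1"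
    and x: "q = galois \<xi> q'"
    by (auto simp: circle_def)
  have ram: "ramification q' = ramification q"
    using ramification_le exp_factor_ramification(1) poly_in_root_galois q q' z(1) x
    by (metis le_antisym)
  define R where "R = {\<omega>::complex. \<omega> ^ ramification q = 1}"
  have z0: "\<zeta> \<noteq> 0"
    using z(2) exp_factor_ramification(1)[OF q] by (auto simp: power_0_left)
  have "root_poly q' = pcompose (root_poly q) [:0, inverse \<zeta>:]"
    by (rule root_poly_eqI[OF q']) (simp add: ram, simp add: z(1) galois_def)
  hence gal: "galois \<omega> q' = galois (\<zeta> * \<omega>) q" for \<omega>
    by (simp add: galois_def ram pcompose_linear_linear inverse_mult_distrib)
  have bij: "bij_betw (\<lambda>\<omega>. \<zeta> * \<omega>) R R"
    by (rule bij_betw_byWitness[where f' = "\<lambda>\<omega>. inverse \<zeta> * \<omega>"])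
       (use z0 z(2) in \<open>auto simp: R_def power_mult_distrib power_inverse simp flip: mult.assoc\<close>)
  have "irr_End_factor q' = (\<Sum>\<omega>\<in>R. \<Sum>\<omega>'\<in>R. slope (galois (\<zeta> * \<omega>) q - galois (\<zeta> * \<omega>') q))"
    by (simp add: num_loops_factor_roots[OF q'] ram R_def gal)
  also have "\<dots> = (\<Sum>\<omega>\<in>R. \<Sum>\<omega>'\<in>R. slope (galois (\<zeta> * \<omega>) q - galois \<omega>' q))"
    by (rule sum.cong[OF refl], rule sum.reindex_bij_betw[OF bij])
  also have "\<dots> = (\<Sum>\<omega>\<in>R. \<Sum>\<omega>'\<in>R. slope (galois \<omega> q - galois \<omega>' q))"
    by (rule sum.reindex_bij_betw[OF bij])
  also have "\<dots> = irr_End_factor q"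
    by (simp add: num_loops_factor_roots[OF q] R_def)
  finally show ?thesis by (simp add: num_loops_factor_def ram)
qed

lemma num_loops_circle:
  assumes "exp_factor q"
  shows "num_loops (circle q) = irr_End_factor q - (rat_of_nat (ramification q))\<^sup>2 + 1"
proof -
  have "exp_factor (SOME q'. exp_factor q' \<and> circle q' = circle q) \<and>
        circle (SOME q'. exp_factor q' \<and> circle q' = circle q) = circle q"
    by (rule someI[of _ q]) (simp add: assms)
  thus ?thesis
    unfolding num_loops_def using num_loops_factor_eq[OF _ assms] num_loops_factor_def by metis
qed

end

theory Submission
  imports Defs
begin

text \<open>
  Write \<open>\<beta>\<close> for the ramification order and p for the polynomial of q in the \<open>\<beta>\<close>-th root x of z.
  As slopes do not depend on the root used to express a factor, the double sum
  Irr(End(I)) collapses to the sum over the \<open>\<beta>\<close>-th roots of unity \<open>\<zeta>\<close> of the degree of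
  \<open>p(x) - p(\<zeta> x)\<close>. The roots \<open>\<zeta>\<close> and \<open>1/\<zeta>\<close> contribute equally, and \<open>\<zeta> = 1\<close> contributes 0, so
  modulo 2 only \<open>\<zeta> = -1\<close> remains, which occurs when \<open>\<beta>\<close> is even. There \<open>p(x) - p(-x)\<close> is odd, and
  nonzero because otherwise q would be a polynomial in the \<open>\<beta>/2\<close>-th root of z. Hence the sum
  is congruent to \<open>\<beta> - 1\<close>, and so to \<open>\<beta>\<^sup>2 - 1\<close>, modulo 2.
\<close>

section \<open>Slopes in an arbitrary root of z\<close>

lemma lookup_subst_root_eq_0:
  assumes "\<And>i. x \<noteq> rat_of_nat i / rat_of_nat b"
  shows "Poly_Mapping.lookup (subst_root b p) x = 0"
  unfolding subst_root_def lookup_sum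
  by (rule sum.neutral) (use assms in \<open>auto simp: lookup_single when_def\<close>)

lemma subst_root_eqI:
  assumes "b \<ge> 1"
    and "\<And>i. Poly_Mapping.lookup f (rat_of_nat i / rat_of_nat b) = coeff p i"
    and "\<And>x. (\<And>i. x \<noteq> rat_of_nat i / rat_of_nat b) \<Longrightarrow> Poly_Mapping.lookup f x = 0"
  shows "f = subst_root b p"
proof (rule poly_mapping_eqI)
  fix x
  show "Poly_Mapping.lookup f x = Poly_Mapping.lookup (subst_root b p) x"
  proof (cases "\<exists>i. x = rat_of_nat i / rat_of_nat b")
    case True
    then show ?thesis using assms(2) lookup_subst_root[OF assms(1)] by auto
  next
    case False
    then show ?thesis using assms(3) lookup_subst_root_eq_0 by metis
  qed
qed

lemma subst_root_diff:
  assumes "b \<ge> 1"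
  shows "subst_root b p - subst_root b p' = subst_root b (p - p')"
  by (rule subst_root_eqI[OF assms])
     (simp_all add: lookup_minus lookup_subst_root[OF assms] lookup_subst_root_eq_0)

lemma keys_subst_root:
  assumes "b \<ge> 1"
  shows "Poly_Mapping.keys (subst_root b p) = {rat_of_nat i / rat_of_nat b | i. coeff p i \<noteq> 0}"
proof (rule set_eqI)
  fix x
  show "x \<in> Poly_Mapping.keys (subst_root b p) \<longleftrightarrow>
        x \<in> {rat_of_nat i / rat_of_nat b | i. coeff p i \<noteq> 0}"
  proof (cases "\<exists>i. x = rat_of_nat i / rat_of_nat b")
    case True
    then show ?thesis
      using assms by (auto simp: lookup_subst_root[OF assms] in_keys_iff)
  next
    case False
    then show ?thesis using lookup_subst_root_eq_0[of x b p] by (auto simp: in_keys_iff)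
  qed
qed

text \<open>The left side sees only the Puiseux polynomial, so the quotient on the right is the same
  for all its representations. Inserting 0 covers \<open>p = 0\<close>, which has degree 0 but no
  keys.\<close>

lemma Max_keys_subst_root:
  assumes "b \<ge> 1"
  shows "Max (insert 0 (Poly_Mapping.keys (subst_root b p))) = rat_of_nat (degree p) / rat_of_nat b"
proof (rule Max_eqI)
  show "finite (insert 0 (Poly_Mapping.keys (subst_root b p)))" by simp
next
  fix y assume "y \<in> insert 0 (Poly_Mapping.keys (subst_root b p))"
  then show "y \<le> rat_of_nat (degree p) / rat_of_nat b"
    by (auto simp: keys_subst_root[OF assms] divide_right_mono le_degree)
next
  show "rat_of_nat (degree p) / rat_of_nat b \<in> insert 0 (Poly_Mapping.keys (subst_root b p))"
    by (cases "p = 0") (auto simp: keys_subst_root[OF assms])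
qed

text \<open>Although \<open>slope\<close> is defined through the least root, its value is the
  largest exponent, which can be read off at any \<open>b\<close>.\<close>

lemma slope_subst_root:
  assumes "b \<ge> 1" "coeff p 0 = 0"
  shows "slope (subst_root b p) = rat_of_nat (degree p) / rat_of_nat b"
proof -
  let ?q = "subst_root b p"
  have q: "exp_factor ?q"
    using assms by (auto simp: exp_factor_def poly_in_root_def)
  have "slope ?q = Max (insert 0 (Poly_Mapping.keys (subst_root (ramification ?q) (root_poly ?q))))"
    using Max_keys_subst_root[OF exp_factor_ramification(1)[OF q], of "root_poly ?q"]
    by (simp add: slope_def irregularity_def)
  then show ?thesis
    using exp_factor_root_poly(1)[OF q] Max_keys_subst_root[OF assms(1), of p] by simp
qed

section \<open>Collapse of the double sum\<close>

definition rotation_degree :: "complex poly \<Rightarrow> complex \<Rightarrow> nat" where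
  "rotation_degree p \<zeta> = degree (p - pcompose p [:0, \<zeta>:])"

text \<open>The invertible substitution of \<open>a * x\<close> for x factors out of both terms and
  preserves degrees.\<close>

lemma degree_diff_rotations:
  fixes p :: "complex poly"
  assumes "a \<noteq> 0"
  shows "degree (pcompose p [:0, a:] - pcompose p [:0, b:]) = rotation_degree p (b / a)"
proof -
  have "pcompose p [:0, a:] - pcompose p [:0, b:]
      = pcompose (p - pcompose p [:0, b / a:]) [:0, a:]"
    using assms by (simp add: pcompose_diff pcompose_linear_linear)
  then show ?thesis
    using assms by (simp add: degree_pcompose rotation_degree_def)
qed

lemma rotation_degree_inverse:
  assumes "\<zeta> \<noteq> 0"
  shows "rotation_degree p (inverse \<zeta>) = rotation_degree p \<zeta>"
proof -
  have "rotation_degree p (inverse \<zeta>) = degree (pcompose p [:0, \<zeta>:] - p)"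
    using degree_diff_rotations[OF assms, of p 1] by (simp add: pcompose_idR inverse_eq_divide)
  also have "\<dots> = rotation_degree p \<zeta>"
    unfolding rotation_degree_def by (metis degree_minus minus_diff_eq)
  finally show ?thesis .
qed

lemma slope_galois_diff:
  assumes q: "exp_factor q" and nz: "\<omega> \<noteq> 0" "\<omega>' \<noteq> 0"
  shows "slope (galois \<omega> q - galois \<omega>' q)
       = rat_of_nat (rotation_degree (root_poly q) (\<omega> / \<omega>')) / rat_of_nat (ramification q)"
proof -
  note ram = exp_factor_ramification(1)[OF q]
  let ?d = "pcompose (root_poly q) [:0, inverse \<omega>:] - pcompose (root_poly q) [:0, inverse \<omega>':]"
  have "coeff ?d 0 = 0"
    by (simp add: coeff_pcompose_linear exp_factor_root_poly(2)[OF q])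
  from slope_subst_root[OF ram this] show ?thesis
    \<comment> \<open>Since \<open>galois\<close> rotates by inverses, the ratio
      \<open>b / a\<close> becomes \<open>\<omega> / \<omega>'\<close>.\<close>
    using degree_diff_rotations[of "inverse \<omega>" "root_poly q" "inverse \<omega>'"] nz
    by (simp add: galois_def subst_root_diff[OF ram] divide_inverse mult.commute)
qed

lemma irr_End_factor_eq_sum_rotation_degree:
  assumes q: "exp_factor q"
  shows "irr_End_factor q
       = rat_of_nat (\<Sum>\<zeta> | \<zeta> ^ ramification q = 1. rotation_degree (root_poly q) \<zeta>)"
proof -
  define b where "b = ramification q"
  define R where "R = {\<zeta>::complex. \<zeta> ^ b = 1}"
  define e where "e = (\<lambda>\<zeta>. rat_of_nat (rotation_degree (root_poly q) \<zeta>) / rat_of_nat b)"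
  have b: "b \<ge> 1" using exp_factor_ramification(1)[OF q] by (simp add: b_def)
  have nz: "\<zeta> \<noteq> 0" if "\<zeta> \<in> R" for \<zeta>
    using that b by (auto simp: R_def power_0_left)
  have "irr_End_factor q = (\<Sum>\<omega>\<in>R. \<Sum>\<omega>'\<in>R. slope (galois \<omega> q - galois \<omega>' q))"
    using num_loops_factor_roots[OF q] by (simp add: R_def b_def)
  also have "\<dots> = (\<Sum>\<omega>\<in>R. \<Sum>\<omega>'\<in>R. e (\<omega> / \<omega>'))"
    by (intro sum.cong refl) (simp add: slope_galois_diff[OF q] nz e_def b_def)
  also have "\<dots> = (\<Sum>\<omega>\<in>R. \<Sum>\<zeta>\<in>R. e \<zeta>)"
  proof (rule sum.cong[OF refl])
    fix \<omega> assume w: "\<omega> \<in> R"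
    \<comment> \<open>Division into the fixed \<open>\<omega>\<close> is an involution of
      \<open>R\<close>, hence its own inverse witness.\<close>
    have "bij_betw (\<lambda>\<omega>'. \<omega> / \<omega>') R R"
      by (rule bij_betw_byWitness[where f' = "\<lambda>\<omega>'. \<omega> / \<omega>'"])
         (use nz w in \<open>auto simp: R_def power_divide\<close>)
    then show "(\<Sum>\<omega>'\<in>R. e (\<omega> / \<omega>')) = (\<Sum>\<zeta>\<in>R. e \<zeta>)"
      by (rule sum.reindex_bij_betw)
  qed
  \<comment> \<open>The constant outer sum yields \<open>card R = b\<close>, which then cancels the
    denominator in \<open>e\<close>.\<close>
  also have "\<dots> = rat_of_nat b * (\<Sum>\<zeta>\<in>R. e \<zeta>)"
    using card_roots_unity_eq[of b] b by (simp add: R_def)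
  also have "\<dots> = (\<Sum>\<zeta>\<in>R. rat_of_nat (rotation_degree (root_poly q) \<zeta>))"
    using b by (simp add: sum_distrib_left e_def)
  finally show ?thesis by (simp add: R_def b_def)
qed

section \<open>Parity of the sum\<close>

lemma odd_rotation_degree_minus_one:
  assumes q: "exp_factor q" and ev: "even (ramification q)"
  shows "odd (rotation_degree (root_poly q) (-1))"
proof -
  define p where "p = root_poly q"
  define r where "r = p - pcompose p [:0, -1:]"
  have cr: "coeff r k = (if even k then 0 else 2 * coeff p k)" for k
    by (simp add: r_def coeff_pcompose_linear)
  obtain c where c: "ramification q = 2 * c" using ev by (elim evenE)
  have c1: "c \<ge> 1" using exp_factor_ramification(1)[OF q] c by simp
  have "r \<noteq> 0"
  proof
    assume "r = 0"
    then have odd0: "coeff p k = 0" if "odd k" for k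
      using cr[of k] that by simp
    \<comment> \<open>As only even powers survive, p(x) is p' evaluated at the square of x, which is
      the \<open>c\<close>-th root of z. The terms with \<open>2 * k > degree p\<close>
      vanish.\<close>
    define p' where "p' = (\<Sum>k\<le>degree p. monom (coeff p (2 * k)) k)"
    have cp': "coeff p' k = coeff p (2 * k)" for k
      by (auto simp: p'_def coeff_sum sum.delta coeff_eq_0)
    have double: "rat_of_nat (2 * i) / rat_of_nat (2 * c) = rat_of_nat i / rat_of_nat c" for i
      by simp
    have "q = subst_root c p'"
    proof (rule subst_root_eqI[OF c1])
      have q2: "q = subst_root (2 * c) p"
        using exp_factor_root_poly(1)[OF q] by (simp add: p_def c)
      have c2: "2 * c \<ge> 1" using c1 by simp
      show "Poly_Mapping.lookup q (rat_of_nat i / rat_of_nat c) = coeff p' i" for i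
        unfolding q2 cp' using lookup_subst_root[OF c2, of p "2 * i"] unfolding double .
      show "Poly_Mapping.lookup q x = 0" if x: "\<And>i. x \<noteq> rat_of_nat i / rat_of_nat c" for x
      proof (cases "\<exists>i. x = rat_of_nat i / rat_of_nat (2 * c)")
        case True
        then obtain i where i: "x = rat_of_nat i / rat_of_nat (2 * c)" by blast
        \<comment> \<open>An even \<open>i\<close> would make \<open>x\<close> a multiple of
          \<open>1 / c\<close>, which is excluded.\<close>
        have "odd i" using x double unfolding i by (metis evenE)
        then show ?thesis unfolding q2 i lookup_subst_root[OF c2] by (rule odd0)
      next
        case False
        then show ?thesis unfolding q2 using lookup_subst_root_eq_0 by blast
      qed
    qed
    moreover have "coeff p' 0 = 0"
      using exp_factor_root_poly(2)[OF q] by (simp add: cp' p_def)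
    ultimately have "ramification q \<le> c"
      using c1 by (intro ramification_le) (auto simp: poly_in_root_def)
    then show False using c c1 by simp
  qed
  \<comment> \<open>Only for nonzero \<open>r\<close> does this hold; the zero polynomial has the
    even degree 0.\<close>
  then have "coeff r (degree r) \<noteq> 0" by simp
  then show ?thesis
    using cr[of "degree r"] unfolding rotation_degree_def r_def p_def by presburger
qed

text \<open>On the unit circle inversion is complex conjugation, so nonreal roots pair up across the
  real axis with equal summands, and the real roots decide the parity.\<close>

lemma even_sum_rotation_degree_iff:
  assumes q: "exp_factor q"
  shows "even (\<Sum>\<zeta> | \<zeta> ^ ramification q = 1. rotation_degree (root_poly q) \<zeta>)
     \<longleftrightarrow> odd (ramification q)"
proof -
  define b where "b = ramification q"
  define e where "e = rotation_degree (root_poly q)"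
  define R where "R = {\<zeta>::complex. \<zeta> ^ b = 1}"
  define P where "P = {\<zeta>\<in>R. Im \<zeta> > 0}"
  define N where "N = {\<zeta>\<in>R. Im \<zeta> < 0}"
  define S where "S = {\<zeta>\<in>R. Im \<zeta> = 0}"
  have b: "b \<ge> 1" using exp_factor_ramification(1)[OF q] by (simp add: b_def)
  have fin: "finite R" using finite_roots_unity[of b] b by (simp add: R_def)
  have norm1: "norm \<zeta> = 1" if "\<zeta> \<in> R" for \<zeta>
    using that b power_eq_1_iff[of \<zeta> b] by (auto simp: R_def)
  have cnj: "e (cnj \<zeta>) = e \<zeta>" if "\<zeta> \<in> R" for \<zeta>
  proof -
    have "\<zeta> * cnj \<zeta> = 1"
      using norm1[OF that] complex_norm_square[of \<zeta>] by simp
    then have "cnj \<zeta> = inverse \<zeta>" "\<zeta> \<noteq> 0"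
      by (auto simp: inverse_unique)
    then show ?thesis by (simp add: e_def rotation_degree_inverse)
  qed
  have "bij_betw cnj P N"
    by (rule bij_betw_byWitness[where f' = cnj])
       (auto simp: P_def N_def R_def simp flip: complex_cnj_power)
  from sum.reindex_bij_betw[OF this, of e] have "sum e N = sum e P"
    using cnj by (simp add: P_def)
  moreover have "sum e R = sum e (P \<union> N) + sum e S"
    by (subst sum.union_disjoint[symmetric])
       (use fin in \<open>auto simp: P_def N_def S_def intro!: sum.cong\<close>)
  moreover have "sum e (P \<union> N) = sum e P + sum e N"
    by (rule sum.union_disjoint) (use fin in \<open>auto simp: P_def N_def\<close>)
  ultimately have "even (sum e R) \<longleftrightarrow> even (sum e S)" by simp
  also have S: "S = (if even b then {1, -1} else {1})"
  proof -
    have "\<zeta> = 1 \<or> \<zeta> = -1" if "\<zeta> \<in> S" for \<zeta>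
      using that norm1[of \<zeta>] by (auto simp: S_def complex_eq_iff norm_complex_def)
    moreover have "1 \<in> S" "-1 \<in> S \<longleftrightarrow> even b"
      by (auto simp: S_def R_def uminus_power_if)
    ultimately show ?thesis by auto
  qed
  have e1: "e 1 = 0" by (simp add: e_def rotation_degree_def pcompose_idR)
  have "even (sum e S) \<longleftrightarrow> odd b"
    using odd_rotation_degree_minus_one[OF q, folded b_def e_def] by (simp add: S e1)
  finally show ?thesis by (simp add: R_def b_def e_def)
qed

theorem lemma4p7:
  fixes q :: puiseux_poly and I :: "puiseux_poly set"
  assumes "exp_factor q" and "I = circle q"
  shows "\<exists>n::int. num_loops I = of_int n \<and> even n"
proof (intro exI conjI)
  let ?s = "\<Sum>\<zeta> | \<zeta> ^ ramification q = 1. rotation_degree (root_poly q) \<zeta>"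
  let ?n = "int ?s - (int (ramification q))\<^sup>2 + 1"
  show "num_loops I = of_int ?n"
    using assms(1) unfolding assms(2)
    by (simp add: num_loops_circle irr_End_factor_eq_sum_rotation_degree)
  \<comment> \<open>The square in \<open>?n\<close> has the parity of \<open>ramification q\<close>,
    opposite to that of \<open>?s\<close>, and the final 1 compensates.\<close>
  have "even (int ?s) \<longleftrightarrow> odd (ramification q)"
    using even_sum_rotation_degree_iff[OF assms(1)] by (simp only: even_of_nat)
  then show "even ?n" by simp
qed

end
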